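(* Let $x\in\{0,1\}^n$ be an unknown binary string with at most $k$ entries equal to $1$. Let $p$ be the deletion probability and $q=1-p$ the retention probability, and assume $q=\Omega(k^{-1/2}\log^{1/2} n)$. Then $\exp\big(O((k/q)^{1/3}\log^{2/3} n)\big)$ independent traces of $x$ suffice to recover $x$ exactly with high probability.
   Context: The deletion channel with deletion probability $p<1$ takes a string $x\in\{0,1\}^n$ and deletes each coordinate independently with probability $p$, outputting the subsequence of surviving coordinates (the positions of deletions are not revealed); each such output is a trace. "With high probability" means with probability at least $1-o(1)$ as $n\to\infty$. *)

theory Defs
  imports "HOL-Probability.Probability"
begin

text \<open>
  A binary string is a \<^typ>\<open>bool list\<close>, with \<^const>\<open>True\<close> standing for the symbol 1.
  The function drawn from the product distribution tells which coordinates survive; only the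
  surviving symbols are output, not their positions.
\<close>

definition deletion_channel :: "real \<Rightarrow> bool list \<Rightarrow> bool list pmf" where
  "deletion_channel p x =
     map_pmf (\<lambda>keep. nths x {i. keep i})
       (Pi_pmf {..<length x} False (\<lambda>_. bernoulli_pmf (1 - p)))"

text \<open>
  One reconstruction function, which may depend on \<open>n\<close>, \<open>k\<close>, \<open>p\<close>, \<open>T\<close> but not on the unknown
  string, has to succeed on every string of length \<open>n\<close> with at most \<open>k\<close> ones, each time with
  failure probability at most \<open>\<delta>\<close> over \<open>T\<close> independent traces.
\<close>

definition traces_suffice :: "nat \<Rightarrow> nat \<Rightarrow> real \<Rightarrow> nat \<Rightarrow> real \<Rightarrow> bool" where
  "traces_suffice n k p T \<delta> \<longleftrightarrow>
     (\<exists>reconstruct :: bool list list \<Rightarrow> bool list.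
        \<forall>x. length x = n \<and> count_list x True \<le> k \<longrightarrow>
          measure_pmf.prob (replicate_pmf T (deletion_channel p x))
            {ts. reconstruct ts = x} \<ge> 1 - \<delta>)"

end

theory Submission
  imports Defs "HOL-Complex_Analysis.Conformal_Mappings" "HOL-Real_Asymp.Real_Asymp"
begin

text \<open>
  To a trace \<open>t\<close> attach the sum over its ones of \<open>u\<close> to the number of earlier ones times \<open>z\<close> to
  the number of earlier zeros. In expectation this becomes, up to the factor \<open>q\<close>, the same sum for
  \<open>x\<close> at \<open>v = p + q u\<close> and \<open>w = p + q z\<close>. With \<open>z = 1 - 1/(2n)\<close> fixed, distinct strings
  yield distinct polynomials in \<open>v\<close> whose difference has coefficients that are either 0 or at
  least \<open>q/(4n)\<close>. The maximum principle, applied to the product of \<open>N\<close> rotations of the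
  difference, shows that it is at least \<open>n\<close> to the power \<open>-O(N)\<close> at some point of the arc of half
  length \<open>pi/N\<close> around 1. There the second moment of the statistic is at most
  \<open>n\<^sup>2 exp(O(k/(q N\<^sup>2)))\<close>, and \<open>N = (k/(q log n))\<close> to the power \<open>1/3\<close> balances the two
  bounds. Second moments and the gap between the means bound the Bhattacharyya coefficient of the
  two trace distributions, hence the error of the maximum likelihood decoder. If \<open>k > n\<^sup>3\<close>, already
  waiting for a trace without deletions is fast enough.
\<close>

subsection \<open>Hypothesis testing\<close>

text \<open>The sum runs over an explicit finite set so that everything stays a finite sum. Wherever
  it is compared with 1, \<open>S\<close> contains both supports.\<close>

definition bhattacharyya :: "'a set \<Rightarrow> 'a pmf \<Rightarrow> 'a pmf \<Rightarrow> real" where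
  "bhattacharyya S P Q = (\<Sum>a\<in>S. sqrt (pmf P a * pmf Q a))"

lemma bhattacharyya_nonneg: "bhattacharyya S P Q \<ge> 0"
  unfolding bhattacharyya_def by (intro sum_nonneg) auto

text \<open>The squared Hellinger distance is \<open>2 - 2 * bhattacharyya S P Q\<close>, and a gap
  between the means of a test function bounds it from below. Raw second moments serve in place of
  variances.\<close>

lemma bhattacharyya_le:
  fixes f :: "'a \<Rightarrow> complex"
  assumes S: "finite S" "set_pmf P \<subseteq> S" "set_pmf Q \<subseteq> S"
    and P: "measure_pmf.expectation P (\<lambda>a. (norm (f a))\<^sup>2) \<le> M"
    and Q: "measure_pmf.expectation Q (\<lambda>a. (norm (f a))\<^sup>2) \<le> M"
    and "M > 0" "0 \<le> \<eta>"
    and diff: "norm (measure_pmf.expectation P f - measure_pmf.expectation Q f) \<ge> \<eta>"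
  shows "bhattacharyya S P Q \<le> 1 - \<eta>\<^sup>2 / (8 * M)"
proof -
  define s where "s a = sqrt (pmf P a)" for a
  define t where "t a = sqrt (pmf Q a)" for a
  have s2: "(s a)\<^sup>2 = pmf P a" and t2: "(t a)\<^sup>2 = pmf Q a" and st: "s a \<ge> 0" "t a \<ge> 0" for a
    by (auto simp: s_def t_def)
  have E: "measure_pmf.expectation R g = (\<Sum>a\<in>S. pmf R a *\<^sub>R g a)"
    if "set_pmf R \<subseteq> S" for R and g :: "'a \<Rightarrow> 'b::{banach, second_countable_topology}"
    using that S(1) by (subst integral_measure_pmf[where A=S]) auto
  \<comment> \<open>Cauchy--Schwarz for \<open>P - Q = (sqrt P - sqrt Q) (sqrt P + sqrt Q)\<close>\<close>
  have "measure_pmf.expectation P f - measure_pmf.expectation Q f =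
      (\<Sum>a\<in>S. (pmf P a - pmf Q a) *\<^sub>R f a)"
    by (simp add: E S scaleR_diff_left sum_subtractf)
  also have "norm \<dots> \<le> (\<Sum>a\<in>S. \<bar>s a - t a\<bar> * ((s a + t a) * norm (f a)))"
  proof (rule order.trans[OF norm_sum], rule sum_mono)
    fix a
    have "pmf P a - pmf Q a = (s a - t a) * (s a + t a)"
      by (simp add: s2[symmetric] t2[symmetric] power2_eq_square algebra_simps)
    then show "norm ((pmf P a - pmf Q a) *\<^sub>R f a) \<le> \<bar>s a - t a\<bar> * ((s a + t a) * norm (f a))"
      using st[of a] by (simp add: abs_mult)
  qed
  finally have "\<eta> \<le> (\<Sum>a\<in>S. \<bar>s a - t a\<bar> * ((s a + t a) * norm (f a)))"
    using diff by linarith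
  then have "\<eta>\<^sup>2 \<le> (\<Sum>a\<in>S. \<bar>s a - t a\<bar> * ((s a + t a) * norm (f a)))\<^sup>2"
    using \<open>0 \<le> \<eta>\<close> by (intro power_mono) auto
  also have "\<dots> \<le> (\<Sum>a\<in>S. \<bar>s a - t a\<bar>\<^sup>2) * (\<Sum>a\<in>S. ((s a + t a) * norm (f a))\<^sup>2)"
    by (rule Cauchy_Schwarz_ineq_sum)
  also have "(\<Sum>a\<in>S. \<bar>s a - t a\<bar>\<^sup>2) = 2 - 2 * bhattacharyya S P Q"
  proof -
    have "(\<Sum>a\<in>S. \<bar>s a - t a\<bar>\<^sup>2) = (\<Sum>a\<in>S. pmf P a + pmf Q a - 2 * sqrt (pmf P a * pmf Q a))"
      by (intro sum.cong) (auto simp: power2_diff s2 t2 s_def t_def real_sqrt_mult)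
    also have "\<dots> = 2 - 2 * bhattacharyya S P Q"
      by (simp add: sum_subtractf sum.distrib sum_pmf_eq_1 S sum_distrib_left bhattacharyya_def)
    finally show ?thesis .
  qed
  also have "(\<Sum>a\<in>S. ((s a + t a) * norm (f a))\<^sup>2) \<le>
      (\<Sum>a\<in>S. 2 * (pmf P a * (norm (f a))\<^sup>2) + 2 * (pmf Q a * (norm (f a))\<^sup>2))"
  proof (rule sum_mono)
    fix a
    have "(s a + t a)\<^sup>2 \<le> 2 * (s a)\<^sup>2 + 2 * (t a)\<^sup>2"
      using sum_squares_bound[of "s a" "t a"] by (simp add: power2_sum)
    then have "(s a + t a)\<^sup>2 * (norm (f a))\<^sup>2 \<le> (2 * pmf P a + 2 * pmf Q a) * (norm (f a))\<^sup>2"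
      by (intro mult_right_mono) (auto simp: s2 t2)
    also have "\<dots> = 2 * (pmf P a * (norm (f a))\<^sup>2) + 2 * (pmf Q a * (norm (f a))\<^sup>2)"
      by (simp add: algebra_simps)
    finally show "((s a + t a) * norm (f a))\<^sup>2 \<le> \<dots>"
      by (simp only: power_mult_distrib)
  qed
  also have "\<dots> \<le> 4 * M"
    using P Q by (simp add: sum.distrib sum_distrib_left[symmetric] E S)
  finally have "\<eta>\<^sup>2 \<le> (2 - 2 * bhattacharyya S P Q) * (4 * M)"
    by (smt (verit) sum_nonneg zero_le_power2 mult_left_mono
        \<open>(\<Sum>a\<in>S. \<bar>s a - t a\<bar>\<^sup>2) = 2 - 2 * bhattacharyya S P Q\<close>)
  then show ?thesis
    using \<open>M > 0\<close> by (simp add: field_simps)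
qed

lemma pmf_replicate_pmf_Cons:
  "pmf (replicate_pmf (Suc T) P) (a # as) = pmf P a * pmf (replicate_pmf T P) as"
proof -
  have "replicate_pmf (Suc T) P = map_pmf (\<lambda>(a, as). a # as) (pair_pmf P (replicate_pmf T P))"
    by (simp add: pair_pmf_def map_bind_pmf)
  moreover have "pmf (map_pmf (\<lambda>(a, as). a # as) (pair_pmf P (replicate_pmf T P)))
      ((\<lambda>(a, as). a # as) (a, as)) = pmf (pair_pmf P (replicate_pmf T P)) (a, as)"
    by (rule pmf_map_inj') (auto simp: inj_def)
  ultimately show ?thesis
    by (simp add: pmf_pair)
qed

text \<open>Tensorization: the square root of a product of likelihoods factors over the
  traces.\<close>

lemma bhattacharyya_replicate_pmf:
  "bhattacharyya {ts. set ts \<subseteq> S \<and> length ts = T} (replicate_pmf T P) (replicate_pmf T Q) =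
    bhattacharyya S P Q ^ T"
proof (induction T)
  case 0
  have "{ts. set ts \<subseteq> S \<and> length ts = 0} = {[]}"
    by auto
  then show ?case
    by (simp add: bhattacharyya_def)
next
  case (Suc T)
  let ?L = "\<lambda>T. {ts. set ts \<subseteq> S \<and> length ts = T}"
  have "bhattacharyya (?L (Suc T)) (replicate_pmf (Suc T) P) (replicate_pmf (Suc T) Q) =
      (\<Sum>(ts, t)\<in>?L T \<times> S. sqrt (pmf (replicate_pmf T P) ts * pmf (replicate_pmf T Q) ts) *
        sqrt (pmf P t * pmf Q t))"
    unfolding bhattacharyya_def lists_length_Suc_eq
    by (subst sum.reindex)
      (auto simp: inj_on_def pmf_replicate_pmf_Cons real_sqrt_mult mult_ac
        simp del: replicate_pmf.simps intro!: sum.cong)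
  also have "\<dots> = bhattacharyya (?L T) (replicate_pmf T P) (replicate_pmf T Q) * bhattacharyya S P Q"
    by (simp add: sum.cartesian_product[symmetric] sum_product bhattacharyya_def)
  also have "\<dots> = bhattacharyya S P Q ^ Suc T"
    by (simp add: Suc.IH)
  finally show ?case .
qed

text \<open>The decoder \<open>r\<close> errs only if some \<open>y \<noteq> x\<close> is at least
  as likely as \<open>x\<close>. There the likelihood of \<open>x\<close> is at most
  \<open>sqrt (L x ts * L y ts)\<close>, so a union bound over \<open>y\<close> leaves a sum of
  Bhattacharyya coefficients.\<close>

lemma maximum_likelihood:
  fixes D :: "'x \<Rightarrow> 'a pmf" and \<beta> :: real
  assumes "finite X" "finite S" and supp: "\<And>x. x \<in> X \<Longrightarrow> set_pmf (D x) \<subseteq> S"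
    and \<beta>: "\<And>x y. x \<in> X \<Longrightarrow> y \<in> X \<Longrightarrow> x \<noteq> y \<Longrightarrow> bhattacharyya S (D x) (D y) \<le> \<beta>"
    and "\<beta> \<ge> 0"
  shows "\<exists>r. \<forall>x\<in>X. measure_pmf.prob (replicate_pmf T (D x)) {ts. r ts = x} \<ge> 1 - card X * \<beta> ^ T"
proof (cases "X = {}")
  case False
  define L where "L x ts = pmf (replicate_pmf T (D x)) ts" for x ts
  have "\<exists>x. x \<in> X \<and> (\<forall>y\<in>X. L y ts \<le> L x ts)" for ts
  proof -
    have "Max ((\<lambda>x. L x ts) ` X) \<in> (\<lambda>x. L x ts) ` X"
      using \<open>finite X\<close> False by (intro Max_in) auto
    then obtain x where "x \<in> X" "L x ts = Max ((\<lambda>x. L x ts) ` X)"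
      by auto
    then show ?thesis
      using \<open>finite X\<close> by auto
  qed
  then obtain r where r: "r ts \<in> X" "\<And>y. y \<in> X \<Longrightarrow> L y ts \<le> L (r ts) ts" for ts
    by metis
  define A where "A = {ts. set ts \<subseteq> S \<and> length ts = T}"
  have finA: "finite A"
    unfolding A_def using \<open>finite S\<close> by (rule finite_lists_length_eq)
  have "1 - card X * \<beta> ^ T \<le> measure_pmf.prob (replicate_pmf T (D x)) {ts. r ts = x}"
    if x: "x \<in> X" for x
  proof -
    let ?P = "replicate_pmf T (D x)"
    have suppA: "set_pmf ?P \<subseteq> A"
      using supp[OF x] by (auto simp: set_replicate_pmf A_def)
    have "1 - measure_pmf.prob ?P {ts. r ts = x} = measure_pmf.prob ?P (- {ts. r ts = x})"
      by (simp add: measure_pmf.prob_compl[symmetric] Compl_eq_Diff_UNIV)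
    also have "\<dots> = measure_pmf.prob ?P ({ts. r ts \<noteq> x} \<inter> A)"
      using suppA by (intro measure_prob_cong_0) (auto simp: set_pmf_iff)
    also have "\<dots> = (\<Sum>ts\<in>{ts. r ts \<noteq> x} \<inter> A. L x ts)"
      using finA by (simp add: measure_measure_pmf_finite L_def)
    also have "\<dots> \<le> (\<Sum>ts\<in>{ts. r ts \<noteq> x} \<inter> A. \<Sum>y\<in>X - {x}. sqrt (L x ts * L y ts))"
    proof (rule sum_mono)
      fix ts assume ts: "ts \<in> {ts. r ts \<noteq> x} \<inter> A"
      have "L x ts = sqrt (L x ts * L x ts)"
        by (simp add: L_def)
      also have "\<dots> \<le> sqrt (L x ts * L (r ts) ts)"
        using r(2)[OF x, of ts] by (intro real_sqrt_le_mono mult_left_mono) (auto simp: L_def)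
      also have "\<dots> \<le> (\<Sum>y\<in>X - {x}. sqrt (L x ts * L y ts))"
        using ts r(1) \<open>finite X\<close>
        by (intro member_le_sum[where f="\<lambda>y. sqrt (L x ts * L y ts)"]) (auto simp: L_def)
      finally show "L x ts \<le> \<dots>" .
    qed
    also have "\<dots> \<le> (\<Sum>ts\<in>A. \<Sum>y\<in>X - {x}. sqrt (L x ts * L y ts))"
      using finA by (intro sum_mono2) (auto simp: L_def intro!: sum_nonneg)
    also have "\<dots> = (\<Sum>y\<in>X - {x}. \<Sum>ts\<in>A. sqrt (L x ts * L y ts))"
      by (rule sum.swap)
    also have "\<dots> \<le> (\<Sum>y\<in>X - {x}. \<beta> ^ T)"
    proof (rule sum_mono)
      fix y assume "y \<in> X - {x}"
      then have "bhattacharyya S (D x) (D y) ^ T \<le> \<beta> ^ T"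
        using \<beta>[OF x, of y] by (intro power_mono bhattacharyya_nonneg) auto
      then show "(\<Sum>ts\<in>A. sqrt (L x ts * L y ts)) \<le> \<beta> ^ T"
        unfolding bhattacharyya_replicate_pmf[symmetric]
        by (simp add: L_def A_def bhattacharyya_def)
    qed
    also have "\<dots> = card (X - {x}) * \<beta> ^ T"
      by simp
    also have "\<dots> \<le> card X * \<beta> ^ T"
      using \<open>\<beta> \<ge> 0\<close> \<open>finite X\<close> by (intro mult_right_mono) (auto simp: card_mono)
    finally show ?thesis
      by linarith
  qed
  then show ?thesis
    by blast
qed auto

subsection \<open>The deletion channel\<close>

lemma deletion_channel_Nil [simp]: "deletion_channel p [] = return_pmf []"
  by (simp add: deletion_channel_def)

text \<open>Coordinate 0 is split off the product distribution and the others are shifted down by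
  one. The inductions over the input string rest on this recursion.\<close>

lemma deletion_channel_Cons:
  "deletion_channel p (b # x) =
     bind_pmf (bernoulli_pmf (1 - p))
       (\<lambda>keep. map_pmf (\<lambda>t. if keep then b # t else t) (deletion_channel p x))"
proof -
  let ?B = "\<lambda>_::nat. bernoulli_pmf (1 - p)"
  have shift: "Pi_pmf {..<n} False ?B = map_pmf (\<lambda>h. h \<circ> Suc) (Pi_pmf (Suc ` {..<n}) False ?B)" for n
    by (rule Pi_pmf_bij_betw) (auto simp: bij_betw_def inj_on_def)
  have "Pi_pmf {..<length (b # x)} False ?B = Pi_pmf (insert 0 (Suc ` {..<length x})) False ?B"
    by (simp add: lessThan_Suc_eq_insert_0)
  also have "\<dots> = do {y \<leftarrow> bernoulli_pmf (1 - p); h \<leftarrow> Pi_pmf (Suc ` {..<length x}) False ?B;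
      return_pmf (h(0 := y))}"
    by (subst Pi_pmf_insert') auto
  finally show ?thesis
    unfolding deletion_channel_def
    by (simp add: shift map_bind_pmf map_pmf_def bind_assoc_pmf bind_return_pmf nths_Cons o_def)
      (intro bind_pmf_cong refl, auto)
qed

lemma length_deletion_channel:
  "t \<in> set_pmf (deletion_channel p x) \<Longrightarrow> length t \<le> length x"
  by (auto simp: deletion_channel_def length_nths intro!: card_mono[of "{..<length x}", simplified])

lemma deletion_channel_full_length:
  "t \<in> set_pmf (deletion_channel p x) \<Longrightarrow> length t = length x \<Longrightarrow> t = x"
proof (induction x arbitrary: t)
  case (Cons b x)
  then show ?case
    by (auto simp: deletion_channel_Cons split: if_splits dest: length_deletion_channel)
qed auto

lemma finite_set_deletion_channel [simp]: "finite (set_pmf (deletion_channel p x))"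
proof (rule finite_subset)
  show "set_pmf (deletion_channel p x) \<subseteq> {t. set t \<subseteq> UNIV \<and> length t \<le> length x}"
    by (auto dest: length_deletion_channel)
qed (rule finite_lists_length_le, simp)

lemma expectation_deletion_channel_Cons:
  fixes g :: "bool list \<Rightarrow> 'b::{banach, second_countable_topology}"
  assumes "0 \<le> p" "p \<le> 1"
  shows "measure_pmf.expectation (deletion_channel p (b # x)) g =
    (1 - p) *\<^sub>R measure_pmf.expectation (deletion_channel p x) (\<lambda>t. g (b # t)) +
    p *\<^sub>R measure_pmf.expectation (deletion_channel p x) g"
  unfolding deletion_channel_Cons
  by (subst pmf_expectation_bind[where A=UNIV]) (use assms in \<open>auto simp: UNIV_bool\<close>)

section \<open>A generating function of traces: mean and second moment\<close>

primrec stat :: "complex \<Rightarrow> complex \<Rightarrow> bool list \<Rightarrow> complex" where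
  "stat u z [] = 0"
| "stat u z (b # t) = (if b then 1 + u * stat u z t else z * stat u z t)"

text \<open>An earlier one contributes \<open>u\<close> if it survives and 1 if it is deleted, on
  average \<open>p + (1 - p) * u\<close>; zeros behave alike with \<open>z\<close>. The factor in
  front is the chance that the counted one itself survives.\<close>

lemma expectation_stat:
  assumes "0 \<le> p" "p \<le> 1"
  shows "measure_pmf.expectation (deletion_channel p x) (stat u z) =
    (1 - p) * stat (p + (1 - p) * u) (p + (1 - p) * z) x"
proof (induction x)
  case (Cons b x)
  have int: "integrable (measure_pmf (deletion_channel p x)) g" for g :: "bool list \<Rightarrow> complex"
    by (rule integrable_measure_pmf_finite) simp
  let ?e = "measure_pmf.expectation (deletion_channel p x) (stat u z)"
  have "measure_pmf.expectation (deletion_channel p (b # x)) (stat u z) =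
      (1 - p) * (if b then 1 + u * ?e else z * ?e) + p * ?e"
    using assms by (simp add: expectation_deletion_channel_Cons int scaleR_conv_of_real)
  then show ?case
    by (simp only: Cons.IH) (simp add: algebra_simps)
qed auto

text \<open>The growth is exponential only in the number of ones, since zeros contribute factors of
  norm at most 1. This is how sparsity enters.\<close>

lemma norm_stat_le:
  fixes r :: real
  assumes "norm z \<le> 1" "norm u \<le> r" "r \<ge> 1"
  shows "norm (stat u z t) \<le> length t * r ^ count_list t True"
proof (induction t)
  case (Cons b t)
  let ?R = "r ^ count_list t True"
  have R: "?R \<ge> 1"
    using assms by simp
  show ?case
  proof (cases b)
    case True
    have "norm (1 + u * stat u z t) \<le> 1 + norm u * norm (stat u z t)"
      by (metis norm_triangle_ineq norm_mult norm_one)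
    also have "\<dots> \<le> r * ?R + r * (length t * ?R)"
      using assms R Cons by (intro add_mono mult_mono) (auto simp: mult_ge1_I)
    finally show ?thesis
      using True by (simp add: algebra_simps)
  next
    case False
    have "norm (z * stat u z t) \<le> 1 * (length t * ?R)"
      unfolding norm_mult using assms Cons by (intro mult_mono) auto
    then show ?thesis
      using False R by (simp add: algebra_simps)
  qed
qed auto

text \<open>The number of surviving ones is binomial, and this is its probability generating
  function.\<close>

lemma expectation_power_count:
  fixes R :: real
  assumes "0 \<le> p" "p \<le> 1"
  shows "measure_pmf.expectation (deletion_channel p x) (\<lambda>t. R ^ count_list t True) =
    (p + (1 - p) * R) ^ count_list x True"
  using assms
  by (induction x) (auto simp: expectation_deletion_channel_Cons algebra_simps)

text \<open>Averaging over the number of surviving ones, instead of bounding it by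
  \<open>count_list x True\<close>, replaces the base \<open>R\<close> by
  \<open>p + (1 - p) * R\<close>. For \<open>R = 1 + \<theta>^2/q^2\<close> with
  \<open>q = 1 - p\<close> the base drops to \<open>1 + \<theta>^2/q\<close>.\<close>

lemma second_moment_stat:
  fixes p R :: real
  assumes p: "0 \<le> p" "p \<le> 1" and "norm z \<le> 1" "(norm u)\<^sup>2 \<le> R" "R \<ge> 1"
  shows "measure_pmf.expectation (deletion_channel p x) (\<lambda>t. (norm (stat u z t))\<^sup>2) \<le>
    (length x)\<^sup>2 * (p + (1 - p) * R) ^ count_list x True"
proof -
  let ?D = "deletion_channel p x"
  have int: "integrable (measure_pmf ?D) g" for g :: "bool list \<Rightarrow> real"
    by (rule integrable_measure_pmf_finite) simp
  have "(norm (stat u z t))\<^sup>2 \<le> (length x)\<^sup>2 * R ^ count_list t True" if "t \<in> set_pmf ?D" for t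
  proof -
    have "norm (stat u z t) \<le> length t * sqrt R ^ count_list t True"
      using assms by (intro norm_stat_le) (auto simp: real_le_rsqrt)
    also have "\<dots> \<le> length x * sqrt R ^ count_list t True"
      using length_deletion_channel[OF that] \<open>R \<ge> 1\<close> by (intro mult_right_mono) auto
    finally have "(norm (stat u z t))\<^sup>2 \<le> (length x * sqrt R ^ count_list t True)\<^sup>2"
      by (intro power_mono) auto
    also have "\<dots> = (length x)\<^sup>2 * R ^ count_list t True"
      using \<open>R \<ge> 1\<close> by (simp add: power_mult_distrib flip: real_sqrt_power)
    finally show ?thesis .
  qed
  then have "measure_pmf.expectation ?D (\<lambda>t. (norm (stat u z t))\<^sup>2) \<le>
      measure_pmf.expectation ?D (\<lambda>t. (length x)\<^sup>2 * R ^ count_list t True)"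
    by (intro integral_mono_AE int AE_pmfI)
  also have "\<dots> = (length x)\<^sup>2 * (p + (1 - p) * R) ^ count_list x True"
    using p by (simp add: expectation_power_count)
  finally show ?thesis .
qed

subsection \<open>Polynomials on a short arc\<close>

text \<open>The \<open>N\<close> rotated copies of the arc cover the circle: \<open>m\<close> rounds
  the angle to the nearest multiple of \<open>2 * pi / N\<close>, and only its residue modulo
  \<open>N\<close> matters for the rotation.\<close>

lemma cis_rotate_to_arc:
  fixes N :: nat
  assumes "N > 0"
  obtains j \<theta> where "j < N" "\<bar>\<theta>\<bar> \<le> pi / N" "cis \<phi> * cis (2 * pi * j / N) = cis \<theta>"
proof -
  define m where "m = round (- \<phi> * N / (2 * pi))"
  define \<theta> where "\<theta> = \<phi> + 2 * pi * m / N"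
  define j where "j = nat (m mod int N)"
  have j: "j < N" "m = int N * (m div int N) + int j"
    using assms by (auto simp: j_def nat_less_iff)
  have "\<bar>of_int m - (- \<phi> * N / (2 * pi))\<bar> \<le> 1 / 2"
    unfolding m_def by (rule of_int_round_abs_le)
  moreover have "\<theta> = (of_int m - (- \<phi> * N / (2 * pi))) * (2 * pi / N)"
    using assms by (simp add: \<theta>_def field_simps)
  ultimately have "\<bar>\<theta>\<bar> \<le> 1 / 2 * \<bar>2 * pi / N\<bar>"
    by (simp only: abs_mult mult_right_mono abs_ge_zero)
  moreover have "cis \<phi> * cis (2 * pi * j / N) = cis \<theta>"
  proof -
    have "real_of_int m = N * (m div int N) + j"
      using arg_cong[OF j(2), of real_of_int] by simp
    then have "\<theta> = \<phi> + 2 * pi * j / N + 2 * pi * of_int (m div int N)"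
      using assms by (simp add: \<theta>_def field_simps)
    then show ?thesis
      by (simp add: cis_mult[symmetric] cis_multiple_2pi)
  qed
  ultimately show ?thesis
    using that j(1) by simp
qed

text \<open>For \<open>z\<close> on the unit circle, one of the \<open>N\<close> factors of
  \<open>H z\<close> is evaluated on the arc and the others are at most \<open>B\<close>, whereas
  \<open>H 0\<close> is the \<open>N\<close>-th power of \<open>poly G 0\<close>.\<close>

lemma poly_large_on_arc_at_0:
  fixes G :: "complex poly"
  assumes "N > 0" and B: "\<And>z. norm z = 1 \<Longrightarrow> norm (poly G z) \<le> B"
  shows "\<exists>\<theta>. \<bar>\<theta>\<bar> \<le> pi / N \<and> norm (poly G 0) ^ N \<le> norm (poly G (cis \<theta>)) * B ^ (N - 1)"
proof -
  have "continuous_on {-(pi / N)..pi / N} (\<lambda>\<theta>. norm (poly G (cis \<theta>)))"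
    by (intro continuous_intros)
  moreover have "{-(pi / N)..pi / N} \<noteq> {}"
    by simp
  ultimately obtain \<theta>0 where \<theta>0: "\<bar>\<theta>0\<bar> \<le> pi / N"
    "\<And>\<theta>. \<bar>\<theta>\<bar> \<le> pi / N \<Longrightarrow> norm (poly G (cis \<theta>)) \<le> norm (poly G (cis \<theta>0))"
    using continuous_attains_sup[of "{-(pi / N)..pi / N}" "\<lambda>\<theta>. norm (poly G (cis \<theta>))"]
    by (metis abs_le_iff atLeastAtMost_iff compact_Icc minus_le_iff)
  define H where "H z = (\<Prod>j<N. poly G (z * cis (2 * pi * j / N)))" for z
  have "norm (H 0) \<le> norm (poly G (cis \<theta>0)) * B ^ (N - 1)"
  proof (rule maximum_modulus_frontier[of H "cball 0 1"])
    show "H holomorphic_on interior (cball 0 1)"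
      unfolding H_def by (intro holomorphic_intros)
    show "continuous_on (closure (cball 0 1)) H"
      unfolding H_def by (intro continuous_intros)
    fix z :: complex
    assume "z \<in> frontier (cball 0 1)"
    then have z: "norm z = 1"
      by (simp add: frontier_cball)
    then have "z = cis (Arg z)"
      using cis_Arg[of z] by (cases "z = 0") (auto simp: sgn_eq)
    with cis_rotate_to_arc[OF \<open>N > 0\<close>, of "Arg z"] obtain j \<theta>
      where j: "j < N" "\<bar>\<theta>\<bar> \<le> pi / N" "z * cis (2 * pi * j / N) = cis \<theta>"
      by metis
    have "norm (H z) = norm (poly G (cis \<theta>)) *
        (\<Prod>i\<in>{..<N} - {j}. norm (poly G (z * cis (2 * pi * i / N))))"
      unfolding H_def prod_norm[symmetric] using j by (subst prod.remove[of _ j]) auto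
    also have "\<dots> \<le> norm (poly G (cis \<theta>0)) * (\<Prod>i\<in>{..<N} - {j}. B)"
      using z by (intro mult_mono \<theta>0 j prod_mono) (auto simp: norm_mult intro!: B prod_nonneg)
    also have "\<dots> = norm (poly G (cis \<theta>0)) * B ^ (N - 1)"
      using j by simp
    finally show "norm (H z) \<le> norm (poly G (cis \<theta>0)) * B ^ (N - 1)" .
  qed auto
  then show ?thesis
    using \<theta>0(1) by (auto simp: H_def norm_power)
qed

lemma poly_large_on_arc:
  fixes D :: "complex poly"
  assumes "D \<noteq> 0" "N > 0" "\<delta> \<ge> 0"
    and B: "\<And>z. norm z = 1 \<Longrightarrow> norm (poly D z) \<le> B"
    and \<delta>: "\<And>i. coeff D i \<noteq> 0 \<Longrightarrow> norm (coeff D i) \<ge> \<delta>"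
  shows "\<exists>\<theta>. \<bar>\<theta>\<bar> \<le> pi / N \<and> \<delta> ^ N \<le> norm (poly D (cis \<theta>)) * B ^ (N - 1)"
proof -
  \<comment> \<open>Dividing by the power of the variable that exactly divides \<open>D\<close> does not change the norm on the unit
    circle and moves the lowest nonzero coefficient to 0.\<close>
  obtain G where G: "D = [:- 0, 1:] ^ order 0 D * G" "\<not> [:- 0, 1:] dvd G"
    using order_decomp[OF \<open>D \<noteq> 0\<close>] by blast
  have D: "D = monom 1 (order 0 D) * G"
    using G(1) by (simp add: monom_altdef)
  have norm_eq: "norm (poly D z) = norm (poly G z)" if "norm z = 1" for z
    by (subst D) (simp add: poly_monom norm_mult norm_power that)
  have "coeff (monom 1 d * G) d = poly G 0" for d
    by (simp add: coeff_monom_mult poly_0_coeff_0)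
  then have "poly G 0 = coeff D (order 0 D)"
    using D by metis
  moreover have "poly G 0 \<noteq> 0"
    using G(2) by (simp add: poly_eq_0_iff_dvd)
  ultimately have "\<delta> ^ N \<le> norm (poly G 0) ^ N"
    using \<delta> \<open>\<delta> \<ge> 0\<close> by (intro power_mono) auto
  with poly_large_on_arc_at_0[OF \<open>N > 0\<close>, of G B] B norm_eq show ?thesis
    by (force intro: order.trans)
qed

section \<open>The polynomial of a string and its coefficients\<close>

primrec stat_poly :: "complex \<Rightarrow> bool list \<Rightarrow> complex poly" where
  "stat_poly w [] = 0"
| "stat_poly w (b # x) = (if b then pCons 1 (stat_poly w x) else smult w (stat_poly w x))"

lemma poly_stat_poly: "poly (stat_poly w x) v = stat v w x"
  by (induction x) auto

text \<open>The coefficient of degree \<open>i\<close> comes from the one preceded by exactly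
  \<open>i\<close> ones, if there is such a one; \<open>g\<close> counts the zeros before
  it.\<close>

lemma coeff_stat_poly:
  "coeff (stat_poly w x) i = 0 \<or> (\<exists>g\<le>length x. coeff (stat_poly w x) i = w ^ g)"
proof (induction x arbitrary: i)
  case (Cons b x)
  show ?case
  proof (cases b)
    case True
    show ?thesis
    proof (cases i)
      case 0
      then show ?thesis
        using \<open>b\<close> by (auto intro!: exI[of _ 0])
    next
      case (Suc j)
      then show ?thesis
        using \<open>b\<close> Cons[of j] by (auto intro: le_SucI)
    qed
  next
    case False
    have "\<exists>h\<le>length (b # x). w * w ^ g = w ^ h" if "g \<le> length x" for g
      using that by (intro exI[of _ "Suc g"]) simp
    with False Cons[of i] show ?thesis
      by auto
  qed
qed auto

text \<open>The constant coefficient reveals the first symbol: it is 1 after a leading one and has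
  norm at most \<open>w < 1\<close> after a leading zero. Equal lengths take care of trailing zeros,
  which leave no mark on the polynomial.\<close>

lemma inj_stat_poly:
  fixes w :: real
  assumes "0 < w" "w < 1" "length x = length y" "stat_poly w x = stat_poly w y"
  shows "x = y"
  using assms(3,4)
proof (induction rule: list_induct2)
  case (Cons b x b' y)
  have *: "pCons 1 A \<noteq> smult (of_real w) (stat_poly w z)" for A z
  proof
    assume "pCons 1 A = smult (of_real w) (stat_poly w z)"
    then have "coeff (pCons 1 A) 0 = coeff (smult (of_real w) (stat_poly w z)) 0"
      by simp
    then have "1 = norm (of_real w * coeff (stat_poly w z) 0)"
      by (metis coeff_pCons_0 coeff_smult norm_one)
    also have "\<dots> \<le> w * 1"
      using coeff_stat_poly[of "of_real w" z 0] assms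
      unfolding norm_mult
      by (intro mult_mono) (auto simp: norm_power power_le_one)
    finally show False
      using assms by simp
  qed
  have "A = B" if "smult (of_real w) A = smult (of_real w) B" for A B :: "complex poly"
    using that assms by (auto simp: poly_eq_iff)
  then show ?case
    using Cons * *[symmetric] by (cases b; cases b') auto
qed simp

lemma power_gap:
  fixes w :: real
  assumes "0 < w" "w < 1" "g < h" "h \<le> n"
  shows "w ^ g - w ^ h \<ge> w ^ n * (1 - w)"
proof -
  have "w ^ g - w ^ h = w ^ g * (1 - w ^ (h - g))"
    using assms by (simp add: algebra_simps flip: power_add)
  moreover have "w ^ n \<le> w ^ g" "w ^ (h - g) \<le> w ^ 1"
    using assms by (intro power_decreasing; simp)+
  ultimately show ?thesis
    using assms by (auto intro!: mult_mono)
qed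

text \<open>Either two distinct powers of \<open>w\<close> are subtracted, which
  \<open>power_gap\<close> handles, or a single power survives, which is larger still.\<close>

lemma coeff_stat_poly_diff:
  fixes w :: real
  assumes "0 < w" "w < 1" "length x = n" "length y = n"
    and "coeff (stat_poly w x - stat_poly w y) i \<noteq> 0"
  shows "norm (coeff (stat_poly w x - stat_poly w y) i) \<ge> w ^ n * (1 - w)"
proof -
  have gap: "norm (of_real w ^ g - of_real w ^ h :: complex) \<ge> w ^ n * (1 - w)"
    if "g \<noteq> h" "g \<le> n" "h \<le> n" for g h
  proof -
    have "norm (of_real w ^ g - of_real w ^ h :: complex) = \<bar>w ^ g - w ^ h\<bar>"
      by (metis norm_of_real of_real_diff of_real_power)
    moreover have "g < h \<or> h < g"
      using that by linarith
    ultimately show ?thesis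
      using power_gap[OF assms(1,2), of g h n] power_gap[OF assms(1,2), of h g n] that by auto
  qed
  have zero: "norm (of_real w ^ g :: complex) \<ge> w ^ n * (1 - w)" if "g \<le> n" for g
  proof -
    have "w ^ n * (1 - w) \<le> w ^ g * 1"
      using assms(1,2) that by (intro mult_mono power_decreasing) auto
    then show ?thesis
      using assms(1) by (simp add: norm_power)
  qed
  show ?thesis
    using coeff_stat_poly[of w x i] coeff_stat_poly[of w y i] assms(3-5) gap zero
    by (elim disjE exE conjE) (auto, metis)
qed

subsection \<open>Sample complexity\<close>

text \<open>At most \<open>2 ^ n \<le> exp n\<close> candidates compete, and each coefficient is at
  most \<open>exp (- \<eta>^2 / (8 * M))\<close>. The constant 16 makes the exponent from
  \<open>T\<close> traces at least \<open>2 * n\<close>. The statistic \<open>f\<close> may depend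
  on the pair, because the decoder only compares likelihoods.\<close>

lemma traces_sufficeI:
  fixes M \<eta> p :: real
  assumes "M > 0" "\<eta> \<ge> 0" and T: "16 * real n * M \<le> T * \<eta>\<^sup>2"
    and sep: "\<And>x y. length x = n \<Longrightarrow> length y = n \<Longrightarrow> count_list x True \<le> k \<Longrightarrow>
      count_list y True \<le> k \<Longrightarrow> x \<noteq> y \<Longrightarrow> \<exists>f :: bool list \<Rightarrow> complex.
        measure_pmf.expectation (deletion_channel p x) (\<lambda>t. (norm (f t))\<^sup>2) \<le> M \<and>
        measure_pmf.expectation (deletion_channel p y) (\<lambda>t. (norm (f t))\<^sup>2) \<le> M \<and>
        \<eta> \<le> norm (measure_pmf.expectation (deletion_channel p x) f -
          measure_pmf.expectation (deletion_channel p y) f)"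
  shows "traces_suffice n k p T (exp (- real n))"
proof -
  define X where "X = {x. length x = n \<and> count_list x True \<le> k}"
  define S where "S = {t :: bool list. set t \<subseteq> UNIV \<and> length t \<le> n}"
  define \<beta> where "\<beta> = exp (- (\<eta>\<^sup>2 / (8 * M)))"
  have S: "finite S"
    unfolding S_def by (rule finite_lists_length_le) simp
  have sub: "X \<subseteq> {x. set x \<subseteq> UNIV \<and> length x = n}"
    by (auto simp: X_def)
  have "finite X"
    by (rule finite_subset[OF sub]) (rule finite_lists_length_eq, simp)
  have "card X \<le> card {x :: bool list. set x \<subseteq> UNIV \<and> length x = n}"
    by (rule card_mono[OF _ sub]) (rule finite_lists_length_eq, simp)
  also have "\<dots> = 2 ^ n"
    by (subst card_lists_length_eq) auto
  finally have card: "real (card X) \<le> 2 ^ n"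
    by (metis of_nat_le_iff of_nat_numeral of_nat_power)
  have supp: "set_pmf (deletion_channel p x) \<subseteq> S" if "x \<in> X" for x
    using that by (auto simp: X_def S_def dest: length_deletion_channel)
  have "\<exists>r. \<forall>x\<in>X. measure_pmf.prob (replicate_pmf T (deletion_channel p x)) {ts. r ts = x} \<ge>
      1 - card X * \<beta> ^ T"
  proof (rule maximum_likelihood[OF \<open>finite X\<close> S supp])
    fix x y assume xy: "x \<in> X" "y \<in> X" "x \<noteq> y"
    with sep[of x y] obtain f :: "bool list \<Rightarrow> complex" where
      "measure_pmf.expectation (deletion_channel p x) (\<lambda>t. (norm (f t))\<^sup>2) \<le> M"
      "measure_pmf.expectation (deletion_channel p y) (\<lambda>t. (norm (f t))\<^sup>2) \<le> M"
      "\<eta> \<le> norm (measure_pmf.expectation (deletion_channel p x) f -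
          measure_pmf.expectation (deletion_channel p y) f)"
      by (auto simp: X_def)
    from bhattacharyya_le[OF S supp[OF xy(1)] supp[OF xy(2)] this(1,2) assms(1,2) this(3)]
    show "bhattacharyya S (deletion_channel p x) (deletion_channel p y) \<le> \<beta>"
      using exp_ge_add_one_self[of "- (\<eta>\<^sup>2 / (8 * M))"] by (simp add: \<beta>_def)
  qed (auto simp: \<beta>_def)
  moreover have "card X * \<beta> ^ T \<le> exp (- real n)"
  proof -
    have "card X * \<beta> ^ T \<le> exp 1 ^ n * \<beta> ^ T"
      using exp_ge_add_one_self[of 1] by (intro mult_right_mono order.trans[OF card] power_mono)
        (auto simp: \<beta>_def)
    also have "\<dots> = exp (n - T * \<eta>\<^sup>2 / (8 * M))"
      by (simp add: \<beta>_def exp_of_nat_mult[symmetric] exp_diff exp_minus field_simps)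
    also have "\<dots> \<le> exp (- real n)"
      using T \<open>M > 0\<close> by (simp add: field_simps)
    finally show ?thesis .
  qed
  ultimately obtain r where
    "\<And>x. x \<in> X \<Longrightarrow> measure_pmf.prob (replicate_pmf T (deletion_channel p x)) {ts. r ts = x} \<ge>
      1 - exp (- real n)"
    by (smt (verit))
  then show ?thesis
    unfolding traces_suffice_def X_def by blast
qed

text \<open>The left side is the squared norm of the solution \<open>u\<close> of
  \<open>(1 - q) + q * u = cis \<theta>\<close>. The numerator contributes
  \<open>q^2 + 2 * (1 - q) * (1 - cos \<theta>)\<close>, and \<open>1 - cos \<theta>\<close> is at
  most \<open>\<theta>^2 / 2\<close>.\<close>

lemma cis_shift_norm:
  fixes q :: real
  assumes "0 < q" "q \<le> 1"
  shows "(norm ((cis \<theta> - (1 - q)) / q))\<^sup>2 \<le> 1 + \<theta>\<^sup>2 / q\<^sup>2"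
proof -
  have "(norm (cis \<theta> - (1 - q)))\<^sup>2 = (cos \<theta> - (1 - q))\<^sup>2 + (sin \<theta>)\<^sup>2"
    by (simp add: cmod_power2)
  also have "\<dots> = q\<^sup>2 + 2 * (1 - q) * (1 - cos \<theta>)"
    by (simp add: sin_squared_eq power2_eq_square algebra_simps)
  also have "2 * (1 - q) * (1 - cos \<theta>) \<le> 2 * 1 * (\<theta>\<^sup>2 / 2)"
  proof -
    have "1 - cos \<theta> = 2 * (sin (\<theta> / 2))\<^sup>2"
      using cos_double_sin[of "\<theta> / 2"] by simp
    also have "(sin (\<theta> / 2))\<^sup>2 \<le> (\<theta> / 2)\<^sup>2"
      by (rule abs_le_square_iff[THEN iffD1]) (rule abs_sin_x_le_abs_x)
    finally have "1 - cos \<theta> \<le> \<theta>\<^sup>2 / 2"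
      by (simp add: power_divide)
    then show ?thesis
      using assms by (intro mult_mono) auto
  qed
  finally have "(norm (cis \<theta> - (1 - q)))\<^sup>2 \<le> q\<^sup>2 + \<theta>\<^sup>2"
    by simp
  then show ?thesis
    using assms by (simp add: norm_divide power_divide field_simps)
qed

lemma separating_stat:
  fixes q :: real
  assumes q: "0 < q" "q \<le> 1" and "n > 0" "N > 0"
    and len: "length x = n" "length y = n"
    and count: "count_list x True \<le> k" "count_list y True \<le> k" and "x \<noteq> y"
  shows "\<exists>f :: bool list \<Rightarrow> complex.
    measure_pmf.expectation (deletion_channel (1 - q) x) (\<lambda>t. (norm (f t))\<^sup>2) \<le>
      n\<^sup>2 * exp (k * (pi / N)\<^sup>2 / q) \<and>
    measure_pmf.expectation (deletion_channel (1 - q) y) (\<lambda>t. (norm (f t))\<^sup>2) \<le>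
      n\<^sup>2 * exp (k * (pi / N)\<^sup>2 / q) \<and>
    q * ((q / (4 * n)) ^ N / (2 * n) ^ (N - 1)) \<le>
      norm (measure_pmf.expectation (deletion_channel (1 - q) x) f -
        measure_pmf.expectation (deletion_channel (1 - q) y) f)"
proof -
  \<comment> \<open>\<open>w\<close> is the image of \<open>z\<close> under
    \<open>z \<mapsto> (1 - q) + q * z\<close>. At distance \<open>q / (2 * n)\<close> from 1,
    Bernoulli's inequality gives \<open>w ^ n \<ge> 1 / 2\<close>, so half of \<open>1 - w\<close>
    bounds the nonzero coefficients from below; this is \<open>\<delta>\<close>.\<close>
  define w where "w = 1 - q / (2 * n)"
  define z where "z = complex_of_real (1 - 1 / (2 * n))"
  define \<delta> where "\<delta> = q / (4 * n)"
  have w: "0 < w" "w < 1"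
    using q \<open>n > 0\<close> by (auto simp: w_def field_simps)
  have wz: "of_real (1 - q) + (1 - of_real (1 - q)) * z = of_real w"
    using \<open>n > 0\<close> by (simp add: w_def z_def field_simps)
  have z: "norm z \<le> 1"
    using \<open>n > 0\<close> by (simp add: z_def norm_of_real del: of_real_diff)
  have "1 + n * (- (q / (2 * n))) \<le> (1 + (- (q / (2 * n)))) ^ n"
    using q \<open>n > 0\<close> by (intro Bernoulli_inequality) (auto simp: field_simps)
  then have "1 / 2 \<le> w ^ n"
    using q \<open>n > 0\<close> by (simp add: w_def)
  then have "1 / 2 * (1 - w) \<le> w ^ n * (1 - w)"
    using w by (intro mult_right_mono) auto
  then have \<delta>: "0 \<le> \<delta>" "\<delta> \<le> w ^ n * (1 - w)"
    using q by (simp_all add: \<delta>_def w_def)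
  define D where "D = stat_poly w x - stat_poly w y"
  have "D \<noteq> 0"
    using inj_stat_poly[OF w] len \<open>x \<noteq> y\<close> by (auto simp: D_def)
  moreover have "norm (poly D v) \<le> 2 * n" if "norm v = 1" for v
    using norm_stat_le[of "of_real w" v 1 x] norm_stat_le[of "of_real w" v 1 y] w len that
      norm_triangle_ineq4[of "stat v w x" "stat v w y"]
    by (simp add: D_def poly_stat_poly)
  moreover have "norm (coeff D i) \<ge> \<delta>" if "coeff D i \<noteq> 0" for i
    using coeff_stat_poly_diff[OF w len] that \<delta> by (fastforce simp: D_def)
  ultimately obtain \<theta> where \<theta>: "\<bar>\<theta>\<bar> \<le> pi / N" "\<delta> ^ N \<le> norm (poly D (cis \<theta>)) * (2 * n) ^ (N - 1)"
    using poly_large_on_arc[of D N \<delta> "2 * n"] \<open>N > 0\<close> \<delta>(1) by fastforce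
  \<comment> \<open>The channel must carry \<open>u\<close> to the arc point
    \<open>cis \<theta>\<close>. Such a \<open>u\<close> never lies inside the unit circle; the
    second moment pays for this.\<close>
  define u where "u = (cis \<theta> - (1 - q)) / q"
  have cis_u: "of_real (1 - q) + (1 - of_real (1 - q)) * u = cis \<theta>"
    using q by (simp add: u_def)
  let ?E = "\<lambda>x. measure_pmf.expectation (deletion_channel (1 - q) x) (stat u z)"
  have E: "?E x = q * stat (cis \<theta>) w x" for x
    using q expectation_stat[of "1 - q" x u z] unfolding cis_u wz by simp
  have "(\<delta> ^ N / (2 * n) ^ (N - 1)) \<le> norm (poly D (cis \<theta>))"
    using \<theta>(2) \<open>n > 0\<close> by (simp add: field_simps)
  then have "q * (\<delta> ^ N / (2 * n) ^ (N - 1)) \<le> q * norm (poly D (cis \<theta>))"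
    using q by (intro mult_left_mono) auto
  also have "\<dots> = norm (?E x - ?E y)"
    using q unfolding E right_diff_distrib[symmetric] norm_mult
    by (simp add: D_def poly_stat_poly)
  finally have diff: "q * (\<delta> ^ N / (2 * n) ^ (N - 1)) \<le> norm (?E x - ?E y)" .
  have moment: "measure_pmf.expectation (deletion_channel (1 - q) x) (\<lambda>t. (norm (stat u z t))\<^sup>2) \<le>
      n\<^sup>2 * exp (k * (pi / N)\<^sup>2 / q)" if "length x = n" "count_list x True \<le> k" for x
  proof -
    have "(norm u)\<^sup>2 \<le> 1 + \<theta>\<^sup>2 / q\<^sup>2"
      unfolding u_def using cis_shift_norm[OF q, of \<theta>] by simp
    then have "measure_pmf.expectation (deletion_channel (1 - q) x) (\<lambda>t. (norm (stat u z t))\<^sup>2) \<le>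
        n\<^sup>2 * ((1 - q) + (1 - (1 - q)) * (1 + \<theta>\<^sup>2 / q\<^sup>2)) ^ count_list x True"
      using second_moment_stat[of "1 - q" z u "1 + \<theta>\<^sup>2 / q\<^sup>2" x] q z that by simp
    also have "(1 - q) + (1 - (1 - q)) * (1 + \<theta>\<^sup>2 / q\<^sup>2) = 1 + \<theta>\<^sup>2 / q"
      using q by (simp add: field_simps power2_eq_square)
    also have "n\<^sup>2 * (1 + \<theta>\<^sup>2 / q) ^ count_list x True \<le> n\<^sup>2 * (1 + \<theta>\<^sup>2 / q) ^ k"
      using q that by (intro mult_left_mono power_increasing) auto
    also have "\<dots> \<le> n\<^sup>2 * exp (\<theta>\<^sup>2 / q) ^ k"
      using q by (intro mult_left_mono power_mono exp_ge_add_one_self) auto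
    also have "\<dots> = n\<^sup>2 * exp (k * \<theta>\<^sup>2 / q)"
      by (simp add: exp_of_nat_mult[symmetric])
    also have "\<dots> \<le> n\<^sup>2 * exp (k * (pi / N)\<^sup>2 / q)"
      using q \<theta>(1) power_mono[OF \<theta>(1), of 2]
      by (intro mult_left_mono) (auto intro!: divide_right_mono mult_left_mono)
    finally show ?thesis .
  qed
  show ?thesis
    using moment[OF len(1) count(1)] moment[OF len(2) count(2)] diff
    unfolding \<delta>_def by (intro exI[of _ "stat u z"]) simp
qed

section \<open>Waiting for a trace without deletions\<close>

lemma expectation_complete_trace:
  assumes "0 \<le> p" "p \<le> 1"
  shows "(1 - p) ^ length x \<le> measure_pmf.expectation (deletion_channel p x) (\<lambda>t. of_bool (t = x))"
proof (induction x)
  case (Cons b x)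
  have "(1 - p) * (1 - p) ^ length x \<le>
      (1 - p) * measure_pmf.expectation (deletion_channel p x) (\<lambda>t. of_bool (t = x))"
    using assms Cons by (intro mult_left_mono) auto
  also have "\<dots> \<le> (1 - p) * measure_pmf.expectation (deletion_channel p x) (\<lambda>t. of_bool (t = x)) +
      p * measure_pmf.expectation (deletion_channel p x) (\<lambda>t. of_bool (t = b # x))"
    using assms by (auto intro!: mult_nonneg_nonneg integral_nonneg_AE)
  finally show ?case
    using assms by (simp add: expectation_deletion_channel_Cons)
qed auto

text \<open>The test function is the indicator of the trace \<open>x\<close>, which \<open>y\<close>
  cannot produce: a trace of full length equals its input.\<close>

lemma separating_complete_trace:
  fixes q :: real
  assumes q: "0 < q" "q \<le> 1" and len: "length x = n" "length y = n" and "x \<noteq> y"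
  shows "\<exists>f :: bool list \<Rightarrow> complex.
    measure_pmf.expectation (deletion_channel (1 - q) x) (\<lambda>t. (norm (f t))\<^sup>2) \<le> 1 \<and>
    measure_pmf.expectation (deletion_channel (1 - q) y) (\<lambda>t. (norm (f t))\<^sup>2) \<le> 1 \<and>
    q ^ n \<le> norm (measure_pmf.expectation (deletion_channel (1 - q) x) f -
      measure_pmf.expectation (deletion_channel (1 - q) y) f)"
proof -
  let ?f = "\<lambda>t. complex_of_real (of_bool (t = x))"
  have "measure_pmf.expectation (deletion_channel (1 - q) y) ?f =
      measure_pmf.expectation (deletion_channel (1 - q) y) (\<lambda>_. 0)"
    using deletion_channel_full_length[of x "1 - q" y] len \<open>x \<noteq> y\<close>
    by (intro integral_cong_AE) (auto simp: AE_measure_pmf_iff)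
  moreover have "q ^ n \<le> norm (measure_pmf.expectation (deletion_channel (1 - q) x) ?f)"
    using expectation_complete_trace[of "1 - q" x] q len
    by (simp only: integral_complex_of_real norm_of_real) simp
  moreover have "measure_pmf.expectation (deletion_channel (1 - q) v) (\<lambda>t. (norm (?f t))\<^sup>2) \<le> 1" for v
    by (intro measure_pmf.integral_le_const integrable_measure_pmf_finite) auto
  ultimately show ?thesis
    by (intro exI[of _ ?f]) simp
qed

text \<open>Disposes of the finitely many small \<open>n\<close>, where the permitted failure
  probability is set to 1.\<close>

lemma traces_suffice_trivial: "traces_suffice n k p 0 1"
  by (simp add: traces_suffice_def)

text \<open>The assumption \<open>1 \<le> q * real n ^ 3\<close> converts every factor
  \<open>1 / q\<close> into a power of \<open>n\<close>, so that only the second moment contributes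
  beyond powers of \<open>n\<close>.\<close>

lemma traces_suffice_by_stat:
  fixes q K :: real and n N k :: nat
  assumes q: "0 < q" "q \<le> 1" and "n \<ge> 17" "N > 0" and nq: "1 \<le> q * real n ^ 3"
    and KN: "k * (pi / N)\<^sup>2 / q \<le> K"
  shows "\<exists>T. real T \<le> exp ((10 + 14 * N) * ln n + K) \<and> traces_suffice n k (1 - q) T (exp (- real n))"
proof -
  define M where "M = (real n)\<^sup>2 * exp (k * (pi / N)\<^sup>2 / q)"
  define \<eta> where "\<eta> = q * ((q / (4 * real n)) ^ N / (2 * real n) ^ (N - 1))"
  define T where "T = nat \<lceil>16 * real n * M / \<eta>\<^sup>2\<rceil>"
  have n: "real n \<ge> 17"
    using \<open>n \<ge> 17\<close> by simp
  have pos: "M > 0" "\<eta> > 0"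
    using q n by (auto simp: M_def \<eta>_def)
  \<comment> \<open>The exponent is 3 for the leading \<open>q\<close>, \<open>5 * N\<close> for the
    coefficient bound and \<open>2 * N\<close> for the upper bound on the circle.\<close>
  have "1 \<le> \<eta> * real n ^ (3 + 7 * N)"
  proof -
    have "1 \<le> q / (4 * real n) * real n ^ 5"
    proof -
      have "1 \<le> q * real n ^ 3 * (n / 4)"
        using nq n by (intro mult_ge1_I[of "q * real n ^ 3"]) auto
      then show ?thesis
        using n by (simp add: field_simps eval_nat_numeral)
    qed
    then have a: "1 \<le> (q / (4 * real n) * real n ^ 5) ^ N"
      by simp
    have "(2 * real n) ^ (N - 1) \<le> (2 * real n) ^ N"
      using n by (intro power_increasing) auto
    also have "\<dots> \<le> (real n ^ 2) ^ N"
      using n by (intro power_mono) (auto simp: power2_eq_square)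
    finally have b: "1 \<le> (real n ^ 2) ^ N / (2 * real n) ^ (N - 1)"
      using n by (simp add: field_simps)
    have "1 \<le> (q * real n ^ 3) *
        ((q / (4 * real n) * real n ^ 5) ^ N * ((real n ^ 2) ^ N / (2 * real n) ^ (N - 1)))"
      using mult_ge1_I[OF nq mult_ge1_I[OF a b]] .
    also have "\<dots> = \<eta> * (real n ^ 3 * (real n ^ 5) ^ N * (real n ^ 2) ^ N)"
      by (simp only: \<eta>_def power_mult_distrib) simp
    also have "real n ^ 3 * (real n ^ 5) ^ N * (real n ^ 2) ^ N = real n ^ (3 + 7 * N)"
      by (simp add: power_add[symmetric] power_mult[symmetric] algebra_simps)
    finally show ?thesis .
  qed
  then have "1 / \<eta> \<le> real n ^ (3 + 7 * N)"
    using pos by (simp add: field_simps)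
  then have "(1 / \<eta>)\<^sup>2 \<le> (real n ^ (3 + 7 * N))\<^sup>2"
    using pos by (intro power_mono) auto
  then have eta: "1 / \<eta>\<^sup>2 \<le> real n ^ (6 + 14 * N)"
    by (simp add: power_divide power_mult[symmetric] algebra_simps)
  \<comment> \<open>Rounding up adds 1 to the factor 16; the resulting 17 is absorbed by one more
    factor \<open>n\<close>, hence \<open>n \<ge> 17\<close>.\<close>
  have "real T \<le> 16 * real n * M * (1 / \<eta>\<^sup>2) + 1"
    using pos unfolding T_def by simp
  also have "\<dots> \<le> 16 * real n * M * real n ^ (6 + 14 * N) + n * M * real n ^ (6 + 14 * N)"
  proof (rule add_mono)
    show "16 * real n * M * (1 / \<eta>\<^sup>2) \<le> 16 * real n * M * real n ^ (6 + 14 * N)"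
      using eta pos by (intro mult_left_mono) auto
    have "1 \<le> M"
      unfolding M_def using n q by (intro mult_ge1_I) auto
    then show "1 \<le> n * M * real n ^ (6 + 14 * N)"
      using n by (intro mult_ge1_I) auto
  qed
  also have "\<dots> \<le> n * (n * M * real n ^ (6 + 14 * N))"
    using mult_right_mono[OF n, of "n * M * real n ^ (6 + 14 * N)"] pos by (simp add: algebra_simps)
  also have "\<dots> = real n ^ (10 + 14 * N) * exp (k * (pi / N)\<^sup>2 / q)"
    by (simp add: M_def power_add eval_nat_numeral)
  also have "\<dots> \<le> real n ^ (10 + 14 * N) * exp K"
    using KN by (intro mult_left_mono) auto
  also have "\<dots> = exp ((10 + 14 * N) * ln n + K)"
  proof -
    have "real n ^ (10 + 14 * N) = exp (ln (real n)) ^ (10 + 14 * N)"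
      using n by simp
    also have "\<dots> = exp ((10 + 14 * N) * ln n)"
      by (rule exp_of_nat_mult[symmetric])
    finally show ?thesis
      by (simp add: exp_add)
  qed
  finally have "real T \<le> exp ((10 + 14 * N) * ln n + K)" .
  moreover have "traces_suffice n k (1 - q) T (exp (- real n))"
  proof (rule traces_sufficeI[of M \<eta>])
    have "16 * real n * M / \<eta>\<^sup>2 \<le> T"
      unfolding T_def by linarith
    then show "16 * real n * M \<le> T * \<eta>\<^sup>2"
      using pos by (simp add: field_simps)
  next
    fix x y :: "bool list"
    assume "length x = n" "length y = n" "count_list x True \<le> k" "count_list y True \<le> k" "x \<noteq> y"
    from separating_stat[OF q _ \<open>N > 0\<close> this]
    show "\<exists>f :: bool list \<Rightarrow> complex.
        measure_pmf.expectation (deletion_channel (1 - q) x) (\<lambda>t. (norm (f t))\<^sup>2) \<le> M \<and>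
        measure_pmf.expectation (deletion_channel (1 - q) y) (\<lambda>t. (norm (f t))\<^sup>2) \<le> M \<and>
        \<eta> \<le> norm (measure_pmf.expectation (deletion_channel (1 - q) x) f -
          measure_pmf.expectation (deletion_channel (1 - q) y) f)"
      using n unfolding M_def \<eta>_def by simp
  qed (use pos in auto)
  ultimately show ?thesis
    by blast
qed

lemma traces_suffice_by_complete_trace:
  fixes q :: real and n k :: nat
  assumes q: "0 < q" "q \<le> 1" and "n \<ge> 17"
  shows "\<exists>T. real T \<le> exp (2 * ln n + 2 * (n * ln (1 / q))) \<and>
    traces_suffice n k (1 - q) T (exp (- real n))"
proof -
  define T where "T = nat \<lceil>16 * n / q ^ (2 * n)\<rceil>"
  have n: "real n \<ge> 17"
    using \<open>n \<ge> 17\<close> by simp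
  have Q: "1 \<le> 1 / q ^ (2 * n)"
    using q by (simp add: power_le_one)
  have "real T \<le> 16 * real n * (1 / q ^ (2 * n)) + 1"
    using q unfolding T_def by simp
  also have "\<dots> \<le> 16 * real n * (1 / q ^ (2 * n)) + n * (1 / q ^ (2 * n))"
    using n Q by (intro add_left_mono mult_ge1_I) auto
  also have "\<dots> = 17 * (n * (1 / q ^ (2 * n)))"
    by simp
  also have "\<dots> \<le> n * (n * (1 / q ^ (2 * n)))"
    using n Q by (intro mult_right_mono) auto
  also have "\<dots> = real n ^ 2 * (1 / q) ^ (2 * n)"
    by (simp add: power2_eq_square power_one_over)
  also have "\<dots> = exp (2 * ln n + 2 * (n * ln (1 / q)))"
  proof -
    have "real n ^ 2 * (1 / q) ^ (2 * n) = exp (ln (real n)) ^ 2 * exp (ln (1 / q)) ^ (2 * n)"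
      using n q by simp
    also have "\<dots> = exp (2 * ln n + 2 * (n * ln (1 / q)))"
      by (simp only: exp_of_nat_mult[symmetric] exp_add[symmetric]) simp
    finally show ?thesis .
  qed
  finally have "real T \<le> exp (2 * ln n + 2 * (n * ln (1 / q)))"
    by simp
  moreover have "traces_suffice n k (1 - q) T (exp (- real n))"
  proof (rule traces_sufficeI[of 1 "q ^ n"])
    have "16 * n / q ^ (2 * n) \<le> T"
      unfolding T_def by linarith
    then show "16 * real n * 1 \<le> T * (q ^ n)\<^sup>2"
      using q by (simp add: field_simps power_mult[symmetric])
  qed (use q separating_complete_trace[OF q] in auto)
  ultimately show ?thesis
    by blast
qed

theorem theorem1:
  fixes c :: real
  assumes "c > 0"
  shows "\<exists>C>0. \<exists>\<epsilon> :: nat \<Rightarrow> real. \<epsilon> \<longlonglongrightarrow> 0 \<and>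
    (\<forall>(n::nat) (k::nat) (p::real) (q::real).
       k \<ge> 1 \<and> 0 \<le> p \<and> p < 1 \<and> q = 1 - p \<and>
       q \<ge> c * real k powr (-1/2) * ln (real n) powr (1/2) \<longrightarrow>
       (\<exists>T::nat. real T \<le> exp (C * ((real k / q) powr (1/3) * ln (real n) powr (2/3))) \<and>
          traces_suffice n k p T (\<epsilon> n)))"
proof -
  \<comment> \<open>From \<open>n0\<close> on, \<open>c * n \<ge> 1\<close>, which the lower bound
    on \<open>q\<close> needs, and \<open>n \<ge> 17\<close>.\<close>
  define n0 where "n0 = nat \<lceil>1 / c\<rceil> + 17"
  define \<epsilon> where "\<epsilon> n = (if n < n0 then 1 else exp (- real n))" for n
  define a where "a = c powr (2/3)"
  \<comment> \<open>The exponents below are at most \<open>24 * S + 24 * l\<close>, where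
    \<open>S\<close> is the target rate and \<open>l = ln n\<close>. The choice of \<open>a\<close>
    gives \<open>l \<le> S / a\<close>, so both terms fit into \<open>C * S\<close>.\<close>
  define C where "C = 24 + 24 / a"
  have a: "a > 0" "a ^ 3 = c\<^sup>2"
    using \<open>c > 0\<close> by (simp_all add: a_def powr_power)
  have "(\<lambda>n. exp (- real n)) \<longlonglongrightarrow> 0"
    by real_asymp
  moreover have "eventually (\<lambda>n. exp (- real n) = \<epsilon> n) sequentially"
    using eventually_ge_at_top[of n0] by eventually_elim (simp add: \<epsilon>_def)
  ultimately have "\<epsilon> \<longlonglongrightarrow> 0"
    by (rule Lim_transform_eventually)
  moreover have "\<exists>T::nat. real T \<le> exp (C * ((real k / q) powr (1/3) * ln (real n) powr (2/3))) \<and>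
      traces_suffice n k p T (\<epsilon> n)"
    if "k \<ge> 1" "0 \<le> p" "p < 1" "q = 1 - p"
      and q_ge: "q \<ge> c * real k powr (-1/2) * ln (real n) powr (1/2)" for n k p q
  proof (cases "n < n0")
    case True
    then show ?thesis
      using traces_suffice_trivial[of n k p] by (intro exI[of _ 0]) (simp add: \<epsilon>_def)
  next
    case False
    have k: "real k \<ge> 1" and q: "0 < q" "q \<le> 1" and p: "p = 1 - q"
      using that by auto
    have n17: "n \<ge> 17" and "real n \<ge> 17" "1 / c \<le> n"
      using False by (auto simp: n0_def) linarith
    define l where "l = ln (real n)"
    have "exp 1 \<le> real n"
      using exp_le \<open>real n \<ge> 17\<close> by linarith
    then have l: "l \<ge> 1"
      using \<open>real n \<ge> 17\<close> by (simp add: l_def ln_ge_iff)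
    have "(c * real k powr (-1/2) * l powr (1/2))\<^sup>2 \<le> q\<^sup>2"
      using q_ge \<open>c > 0\<close> by (intro power_mono) (auto simp: l_def)
    also have "(c * real k powr (-1/2) * l powr (1/2))\<^sup>2 = c\<^sup>2 * (1 / k) * l"
      using k l by (simp add: power_mult_distrib power_divide powr_power powr_minus_divide)
    finally have q2: "c\<^sup>2 * l \<le> q\<^sup>2 * k"
      using k by (simp add: field_simps)
    define S where "S = (k / q) powr (1/3) * l powr (2/3)"
    have "S > 0"
      using k q l by (auto simp: S_def)
    have S3: "S ^ 3 = k / q * l\<^sup>2"
      using k q l by (simp add: S_def power_mult_distrib powr_power)
    have "(a * l) ^ 3 \<le> S ^ 3"
    proof -
      have "(a * l) ^ 3 = c\<^sup>2 * l * l\<^sup>2"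
        by (simp only: power_mult_distrib a) (simp add: power3_eq_cube power2_eq_square)
      also have "\<dots> \<le> q\<^sup>2 * k * l\<^sup>2"
        using q2 by (intro mult_right_mono) auto
      also have "\<dots> \<le> k / q * l\<^sup>2"
        using q k power_le_one[of q 3] by (intro mult_right_mono)
          (auto simp: field_simps power2_eq_square power3_eq_cube)
      finally show ?thesis
        by (simp add: S3)
    qed
    then have "a * l \<le> S"
      using a l \<open>S > 0\<close> by (simp add: power_mono_iff)
    then have "l \<le> S / a"
      using a by (simp add: field_simps)
    moreover have "C * S = 24 * S + 24 * (S / a)"
      by (simp add: C_def algebra_simps)
    ultimately have CS: "24 * S + 24 * l \<le> C * S"
      by simp
    have "\<exists>T. real T \<le> exp (C * S) \<and> traces_suffice n k (1 - q) T (exp (- real n))"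
    \<comment> \<open>For \<open>k \<le> n ^ 3\<close> the assumption on \<open>q\<close> forces
      \<open>q \<ge> 1 / n ^ 3\<close>, as the statistic requires. For larger \<open>k\<close>, the
      rate \<open>S\<close> already dominates \<open>n * ln (1 / q)\<close>.\<close>
    proof (cases "k \<le> n ^ 3")
      case True
      have nq: "1 \<le> q * real n ^ 3"
      proof -
        have "1 \<le> c\<^sup>2 * (real n)\<^sup>2"
          using \<open>1 / c \<le> n\<close> \<open>c > 0\<close> one_le_power[of "c * n" 2]
          by (simp add: field_simps power_mult_distrib)
        also have "\<dots> \<le> c\<^sup>2 * l * (real n)\<^sup>2"
          using l mult_left_mono[of 1 l "c\<^sup>2"] by (intro mult_right_mono) auto
        also have "\<dots> \<le> q\<^sup>2 * k * (real n)\<^sup>2"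
          using q2 by (intro mult_right_mono) auto
        also have "\<dots> \<le> q\<^sup>2 * real n ^ 3 * (real n)\<^sup>2"
        proof -
          have "real k \<le> real n ^ 3"
            using True by (metis of_nat_le_iff of_nat_power)
          then show ?thesis
            by (intro mult_right_mono mult_left_mono) auto
        qed
        also have "\<dots> = q\<^sup>2 * real n ^ 5"
          by (simp add: eval_nat_numeral)
        also have "\<dots> \<le> q\<^sup>2 * real n ^ 6"
          using \<open>real n \<ge> 17\<close> by (intro mult_left_mono power_increasing) auto
        also have "\<dots> = (q * real n ^ 3)\<^sup>2"
          by (simp add: power_mult_distrib flip: power_mult)
        finally have "1\<^sup>2 \<le> (q * real n ^ 3)\<^sup>2"
          by simp
        then show ?thesis
          by (rule power2_le_imp_le) (use q in auto)
      qed
      \<comment> \<open>Here \<open>S / l\<close> is the cube root of \<open>k / (q * l)\<close>.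
        With this \<open>N\<close> the gap costs \<open>14 * N * l \<le> 14 * S + 14 * l\<close> and
        the second moment at most \<open>10 * S\<close>; with the remaining \<open>10 * l\<close>
        both coefficients become 24.\<close>
      define N where "N = nat \<lceil>S / l\<rceil>"
      have "S / l > 0"
        using l \<open>S > 0\<close> by simp
      then have N: "N > 0" "S / l \<le> N" "N \<le> S / l + 1"
        unfolding N_def by linarith+
      have "k * (pi / N)\<^sup>2 / q \<le> k * (pi / (S / l))\<^sup>2 / q"
        using q N(2) \<open>S / l > 0\<close>
        by (intro divide_right_mono mult_left_mono power_mono frac_le) auto
      also have "\<dots> = pi\<^sup>2 * (k / q * l\<^sup>2) / S\<^sup>2"
        using l \<open>S > 0\<close> by (simp add: field_simps)
      also have "\<dots> = pi\<^sup>2 * S"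
        unfolding S3[symmetric] using \<open>S > 0\<close> by (simp add: power3_eq_cube power2_eq_square)
      also have "\<dots> \<le> 10 * S"
      proof -
        have "pi\<^sup>2 \<le> (3.15)\<^sup>2"
          using pi_approx by (intro power_mono) auto
        then show ?thesis
          using \<open>S > 0\<close> by (intro mult_right_mono) (auto simp: power2_eq_square)
      qed
      finally obtain T where T: "real T \<le> exp ((10 + 14 * N) * ln n + 10 * S)"
        "traces_suffice n k (1 - q) T (exp (- real n))"
        using traces_suffice_by_stat[OF q n17 N(1) nq] by blast
      have "N * l \<le> S + l"
        using N l by (simp add: field_simps)
      then have "(10 + 14 * N) * ln n + 10 * S \<le> 24 * S + 24 * l"
        unfolding l_def[symmetric] by (simp add: algebra_simps)
      also have "\<dots> \<le> C * S"
        by (rule CS)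
      finally show ?thesis
        using T by (meson exp_le_cancel_iff order.trans)
    next
      case False
      obtain T where T: "real T \<le> exp (2 * ln n + 2 * (n * ln (1 / q)))"
        "traces_suffice n k (1 - q) T (exp (- real n))"
        using traces_suffice_by_complete_trace[OF q n17] by blast
      have "n * ln (1 / q) \<le> 3 * S"
      proof -
        \<comment> \<open>Taking the cube root before applying \<open>ln t \<le> t - 1\<close>
          produces the power 1/3 of \<open>1 / q\<close> that occurs in \<open>S\<close>; the
          matching power of \<open>k\<close> comes from \<open>n ^ 3 < k\<close>.\<close>
        have "ln (1 / q) = 3 * ln ((1 / q) powr (1/3))"
          using q by (simp add: ln_powr)
        also have "\<dots> \<le> 3 * (1 / q) powr (1/3)"
          using q ln_le_minus_one[of "(1 / q) powr (1/3)"] by simp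
        finally have "n * ln (1 / q) \<le> n * (3 * (1 / q) powr (1/3))"
          by (intro mult_left_mono) auto
        also have "real n \<le> k powr (1/3)"
        proof -
          have "(real n ^ 3) powr (1/3) \<le> real k powr (1/3)"
            using False by (intro powr_mono2) (auto simp flip: of_nat_power)
          then show ?thesis
            using \<open>real n \<ge> 17\<close> powr_powr[of "real n" 3 "1/3"] by simp
        qed
        also have "k powr (1/3) * (3 * (1 / q) powr (1/3)) = 3 * (k / q) powr (1/3) * 1"
          using q by (simp add: powr_divide)
        also have "\<dots> \<le> 3 * (k / q) powr (1/3) * l powr (2/3)"
          using l by (intro mult_left_mono ge_one_powr_ge_zero) auto
        finally show ?thesis
          by (simp add: S_def mult_right_mono)
      qed
      then have "2 * ln n + 2 * (n * ln (1 / q)) \<le> 6 * S + 2 * l"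
        by (simp add: l_def)
      also have "\<dots> \<le> 24 * S + 24 * l"
        using \<open>S > 0\<close> l by simp
      also have "\<dots> \<le> C * S"
        by (rule CS)
      finally show ?thesis
        using T by (meson exp_le_cancel_iff order.trans)
    qed
    then show ?thesis
      using False by (simp add: S_def l_def \<epsilon>_def p)
  qed
  moreover have "C > 0"
    using a by (simp add: C_def add_pos_pos)
  ultimately show ?thesis
    by blast
qed

end
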